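(* Let $s,n\in\mathbb N$ with $s\le n$ and let $p,q,R,\alpha,\eta>0$ satisfy $$p\le\frac1{2^{11}s^2},\qquad 2p\le q\le\alpha<1,\qquad R\ge2^{-6}pn,\qquad\eta\le\frac{(1-\alpha)^{2s}}4.$$ Let $\mathcal H$ be an $s$-uniform hypergraph with $n$ vertices and let $$\mathcal J=\{L\subset V(\mathcal H):\mathcal H[L]\text{ is }(p/(q-p),\eta R)\text{-Janson}\}.$$ Then there exist a family $\mathcal Y\subset2^{V(\mathcal H)}\times2^{V(\mathcal H)}$ and functions $g:\mathcal I(\mathcal J)\to\mathcal Y$, $f:\mathcal Y\to2^{V(\mathcal H)}$ such that: (1) for every $I\in\mathcal I(\mathcal J)$, if $g(I)=(S,T)$ then $S\cup T\subset I\subset f(S,T)$; (2) every $(S,T)\in\mathcal Y$ satisfies $|S|\le2^{11}ps^2n$ and $|T|\le qn/\alpha$; (3) for every $Y\in\mathcal Y$, the hypergraph $\mathcal H[f(Y)]$ is not $(p,R)$-Janson.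
   Context: A hypergraph is identified with its edge set; $\mathcal H[L]=\{E\in\mathcal H:E\subset L\}$. $\mathcal I(\mathcal J)$ denotes the family of independent sets of $\mathcal J$ (subsets of the vertex set $V(\mathcal H)$ containing no edge of $\mathcal J$). For $\nu:\mathcal G\to\mathbb R_{\ge0}$: $e(\nu)=\sum_E\nu(E)$, $d_\nu(L)=\sum_{E\in\mathcal G,L\subset E}\nu(E)$, $\Lambda_p(\nu)=\sum_{L\subset V(\mathcal G),|L|\ge2}d_\nu(L)^2p^{-|L|}$. For $p,R>0$, $\mathcal G$ is $(p,R)$-Janson if some $\nu:\mathcal G\to\mathbb R_{\ge0}$ has $\Lambda_p(\nu)<e(\nu)^2/R$. *)

theory Defs
  imports Complex_Main
begin

text \<open>Hypergraphs are identified with their edge sets; the vertex set V is carried separately.\<close>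

definition induced :: "'a set set \<Rightarrow> 'a set \<Rightarrow> 'a set set" where
  "induced H L = {E \<in> H. E \<subseteq> L}"

definition indep_sets :: "'a set \<Rightarrow> 'a set set \<Rightarrow> 'a set set" where
  "indep_sets V J = {I. I \<subseteq> V \<and> (\<forall>E\<in>J. \<not> E \<subseteq> I)}"

definition e_nu :: "'a set set \<Rightarrow> ('a set \<Rightarrow> real) \<Rightarrow> real" where
  "e_nu G \<nu> = (\<Sum>E\<in>G. \<nu> E)"

definition deg_nu :: "'a set set \<Rightarrow> ('a set \<Rightarrow> real) \<Rightarrow> 'a set \<Rightarrow> real" where
  "deg_nu G \<nu> L = (\<Sum>E\<in>{E \<in> G. L \<subseteq> E}. \<nu> E)"

definition Lambda :: "'a set \<Rightarrow> 'a set set \<Rightarrow> real \<Rightarrow> ('a set \<Rightarrow> real) \<Rightarrow> real" where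
  "Lambda V G p \<nu> = (\<Sum>L\<in>{L. L \<subseteq> V \<and> card L \<ge> 2}. (deg_nu G \<nu> L)^2 * p powi (- int (card L)))"

definition janson :: "'a set \<Rightarrow> 'a set set \<Rightarrow> real \<Rightarrow> real \<Rightarrow> bool" where
  "janson V G p R \<longleftrightarrow> (\<exists>\<nu>::'a set \<Rightarrow> real. (\<forall>E\<in>G. \<nu> E \<ge> 0) \<and> Lambda V G p \<nu> < (e_nu G \<nu>)^2 / R)"

end

theory Submission
  imports Defs "HOL-Analysis.Convex"
begin

text \<open>
  Let \<open>P\<close> be a \<open>q\<close>-random subset of \<open>V\<close>. For a decreasing property \<open>D\<close>, let \<open>w(T)\<close> be the
  probability that \<open>P \<union> T\<close> satisfies \<open>D\<close>. If every subset of \<open>I\<close> satisfies \<open>D\<close>, take \<open>T \<subseteq> I\<close>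
  maximal with \<open>w(T) \<le> (1 - \<alpha>)^|T|\<close>. As \<open>w(T) \<ge> (1 - q)^n\<close>, this forces \<open>|T| \<le> q n / \<alpha>\<close>, and
  by maximality enlarging \<open>T\<close> inside \<open>I\<close> shrinks \<open>w\<close> by no more than a factor \<open>1 - \<alpha>\<close> per vertex.

  This is used twice. First, \<open>D\<close> says that a set is not in \<open>\<J>\<close>. Let \<open>F\<close> be the set of edges \<open>E\<close>
  with \<open>w(T \<union> E) \<ge> (1 - \<alpha>)^|E - T| w(T)\<close>; it contains all edges inside \<open>I\<close>. A Janson measure on
  \<open>F\<close>, restricted to \<open>P \<union> T\<close> conditioned on \<open>D\<close>, keeps a \<open>(1 - \<alpha>)^s\<close> fraction of its normalised
  mass, while by Harris' inequality \<open>\<Lambda>\<close> does not grow, so some set outside \<open>\<J>\<close> would be Janson.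
  Hence \<open>F\<close> is not \<open>(p, R/4)\<close>-Janson.

  Second, with \<open>p\<close>-random subsets and \<open>\<delta> = 1 / (2^11 s^2)\<close> in place of \<open>\<alpha>\<close>, \<open>D\<close> says that a set is
  independent in \<open>H - F\<close>. The container consists of all \<open>v\<close> with \<open>w(S + v) \<ge> (1 - \<delta>) w(S)\<close>. Order
  \<open>V\<close>, and reveal each edge vertex by vertex up to the first one missing from \<open>P \<union> S\<close>: the missing
  vertex is pivotal for \<open>D\<close>, which has small probability, and a second moment bound shows that
  \<open>H - F\<close> inside the container is not \<open>(p, R/4)\<close>-Janson either.
\<close>

section \<open>Random subsets and fingerprints\<close>

text \<open>A finite weighted sum instead of a measure: the linear identities hold for every real
  \<open>q\<close>, and only the inequalities ask for a probability.\<close>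

definition bern_expect :: "'a set \<Rightarrow> real \<Rightarrow> ('a set \<Rightarrow> real) \<Rightarrow> real" where
  "bern_expect V q f = (\<Sum>P\<in>Pow V. q ^ card P * (1 - q) ^ card (V - P) * f P)"

lemma bern_expect_empty [simp]: "bern_expect {} q f = f {}"
  by (simp add: bern_expect_def)

lemma bern_expect_insert:
  assumes "finite V" "x \<notin> V"
  shows "bern_expect (insert x V) q f =
    (1 - q) * bern_expect V q f + q * bern_expect V q (\<lambda>P. f (insert x P))"
proof -
  let ?g = "\<lambda>P. q ^ card P * (1 - q) ^ card (insert x V - P) * f P"
  have inj: "inj_on (insert x) (Pow V)"
    using assms(2) by (auto simp: inj_on_def)
  have "bern_expect (insert x V) q f = sum ?g (Pow V) + sum ?g (insert x ` Pow V)"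
    unfolding bern_expect_def Pow_insert using assms
    by (intro sum.union_disjoint) auto
  also have "sum ?g (Pow V) = (1 - q) * bern_expect V q f"
    unfolding bern_expect_def sum_distrib_left
  proof (rule sum.cong)
    fix P assume "P \<in> Pow V"
    then have "insert x V - P = insert x (V - P)" "x \<notin> V - P"
      using assms(2) by auto
    then show "?g P = (1 - q) * (q ^ card P * (1 - q) ^ card (V - P) * f P)"
      using assms(1) by simp
  qed simp
  also have "sum ?g (insert x ` Pow V) = q * bern_expect V q (\<lambda>P. f (insert x P))"
    unfolding bern_expect_def sum_distrib_left sum.reindex[OF inj] o_def
  proof (rule sum.cong)
    fix P assume "P \<in> Pow V"
    then have "insert x V - insert x P = V - P" "x \<notin> P" "finite P"
      using assms by (auto intro: finite_subset)
    then show "?g (insert x P) = q * (q ^ card P * (1 - q) ^ card (V - P) * f (insert x P))"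
      by simp
  qed simp
  finally show ?thesis .
qed

lemma bern_expect_const:
  assumes "finite V"
  shows "bern_expect V q (\<lambda>P. c) = c"
  using assms by (induction V) (simp_all add: bern_expect_insert algebra_simps)

lemma bern_expect_add:
  "bern_expect V q (\<lambda>P. f P + g P) = bern_expect V q f + bern_expect V q g"
  by (simp add: bern_expect_def sum.distrib algebra_simps)

lemma bern_expect_diff:
  "bern_expect V q (\<lambda>P. f P - g P) = bern_expect V q f - bern_expect V q g"
  by (simp add: bern_expect_def sum_subtractf algebra_simps)

lemma bern_expect_cmult:
  "bern_expect V q (\<lambda>P. c * f P) = c * bern_expect V q f"
  by (simp add: bern_expect_def sum_distrib_left algebra_simps)

lemma bern_expect_sum:
  "bern_expect V q (\<lambda>P. \<Sum>i\<in>A. f i P) = (\<Sum>i\<in>A. bern_expect V q (f i))"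
  unfolding bern_expect_def sum_distrib_left by (rule sum.swap)

lemma bern_expect_cong:
  assumes "\<And>P. P \<subseteq> V \<Longrightarrow> f P = g P"
  shows "bern_expect V q f = bern_expect V q g"
  unfolding bern_expect_def using assms by (intro sum.cong) auto

lemma bern_expect_mono:
  assumes "0 \<le> q" "q \<le> 1" "\<And>P. P \<subseteq> V \<Longrightarrow> f P \<le> g P"
  shows "bern_expect V q f \<le> bern_expect V q g"
  unfolding bern_expect_def using assms by (intro sum_mono mult_left_mono) auto

lemma bern_expect_forced_vertex:
  assumes "finite V" "v \<in> V"
  shows "bern_expect V q (\<lambda>P. of_bool (v \<in> P) * f P) = q * bern_expect V q (\<lambda>P. f (insert v P))"
proof -
  obtain W where W: "V = insert v W" "v \<notin> W" "finite W"
    using assms by (metis finite_insert mk_disjoint_insert)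
  have "bern_expect W q (\<lambda>P. of_bool (v \<in> P) * f P) = bern_expect W q (\<lambda>P. 0)"
    using W by (intro bern_expect_cong) auto
  then show ?thesis
    using W by (simp add: bern_expect_insert bern_expect_const algebra_simps)
qed

text \<open>Independence: given that \<open>A\<close> is selected, the rest of \<open>P\<close>
  keeps its law, so \<open>P\<close> may be replaced by \<open>P \<union> A\<close>. Vertices are
  forced one at a time, with \<open>f\<close> changing along the induction.\<close>

lemma bern_expect_forced:
  assumes "finite V" "A \<subseteq> V"
  shows "bern_expect V q (\<lambda>P. of_bool (A \<subseteq> P) * f P) = q ^ card A * bern_expect V q (\<lambda>P. f (P \<union> A))"
proof -
  have "finite A" using assms finite_subset by blast
  then show ?thesis using assms(2)
  proof (induction A arbitrary: f)
    case empty
    then show ?case by simp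
  next
    case (insert v A)
    have "bern_expect V q (\<lambda>P. of_bool (insert v A \<subseteq> P) * f P) =
        bern_expect V q (\<lambda>P. of_bool (v \<in> P) * (of_bool (A \<subseteq> P) * f P))"
      by (intro bern_expect_cong) auto
    also have "\<dots> = q * bern_expect V q (\<lambda>P. of_bool (A \<subseteq> insert v P) * f (insert v P))"
      using insert.prems assms(1) by (subst bern_expect_forced_vertex) auto
    also have "bern_expect V q (\<lambda>P. of_bool (A \<subseteq> insert v P) * f (insert v P)) =
        bern_expect V q (\<lambda>P. of_bool (A \<subseteq> P) * f (insert v P))"
      using insert.hyps by (intro bern_expect_cong) (auto simp: subset_insert)
    also have "\<dots> = q ^ card A * bern_expect V q (\<lambda>P. f (insert v (P \<union> A)))"
      using insert.prems by (intro insert.IH) auto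
    finally show ?case using insert.hyps by simp
  qed
qed

lemma bern_expect_subset:
  assumes "finite V" "A \<subseteq> V"
  shows "bern_expect V q (\<lambda>P. of_bool (A \<subseteq> P)) = q ^ card A"
  using bern_expect_forced[OF assms, of q "\<lambda>_. 1"] assms(1) by (simp add: bern_expect_const)

text \<open>Condition on one vertex. The induction hypothesis handles both halves; what remains is
  that \<open>q * (1 - q) * (f1 - f0) * (g0 - g1)\<close> is nonnegative, which is monotonicity in
  that vertex.\<close>

lemma bern_expect_harris:
  assumes "finite V" "0 \<le> q" "q \<le> 1"
    and "\<And>A B. A \<subseteq> B \<Longrightarrow> B \<subseteq> V \<Longrightarrow> f A \<le> f B"
    and "\<And>A B. A \<subseteq> B \<Longrightarrow> B \<subseteq> V \<Longrightarrow> g B \<le> g A"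
  shows "bern_expect V q (\<lambda>P. f P * g P) \<le> bern_expect V q f * bern_expect V q g"
  using assms(1,4,5)
proof (induction V arbitrary: f g)
  case empty
  then show ?case by simp
next
  case (insert x V)
  define f0 f1 g0 g1 where "f0 = bern_expect V q f"
    and "f1 = bern_expect V q (\<lambda>P. f (insert x P))"
    and "g0 = bern_expect V q g" and "g1 = bern_expect V q (\<lambda>P. g (insert x P))"
  have "f0 \<le> f1" unfolding f0_def f1_def
    using assms(2,3) by (intro bern_expect_mono insert.prems(1)) auto
  moreover have "g1 \<le> g0" unfolding g0_def g1_def
    using assms(2,3) by (intro bern_expect_mono insert.prems(2)) auto
  ultimately have "0 \<le> (q * (1 - q)) * ((f1 - f0) * (g0 - g1))"
    using assms(2,3) by (intro mult_nonneg_nonneg) auto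
  moreover have "bern_expect V q (\<lambda>P. f P * g P) \<le> f0 * g0"
    unfolding f0_def g0_def by (intro insert.IH insert.prems) auto
  then have "(1 - q) * bern_expect V q (\<lambda>P. f P * g P) \<le> (1 - q) * (f0 * g0)"
    using assms(3) by (intro mult_left_mono) auto
  moreover have "bern_expect V q (\<lambda>P. f (insert x P) * g (insert x P)) \<le> f1 * g1"
    unfolding f1_def g1_def by (intro insert.IH insert.prems) auto
  then have "q * bern_expect V q (\<lambda>P. f (insert x P) * g (insert x P)) \<le> q * (f1 * g1)"
    using assms(2) by (intro mult_left_mono) auto
  ultimately show ?case
    unfolding bern_expect_insert[OF insert.hyps] f0_def[symmetric] f1_def[symmetric]
      g0_def[symmetric] g1_def[symmetric]
    by (simp add: algebra_simps)
qed

text \<open>Since \<open>1 - q\<close> is the mean of \<open>1 - \<alpha>\<close> and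
  \<open>1\<close> with weights \<open>q / \<alpha>\<close> and \<open>1 - q / \<alpha>\<close>,
  weighted AM-GM gives \<open>(1 - \<alpha>) powr (q / \<alpha>) \<le> 1 - q\<close>. Logarithms
  then compare the exponents; \<open>ln (1 - \<alpha>) < 0\<close> reverses the inequality.\<close>

lemma power_le_power_imp_le_ratio:
  fixes q \<alpha> :: real
  assumes "0 < q" "q \<le> \<alpha>" "\<alpha> < 1" "(1 - q) ^ n \<le> (1 - \<alpha>) ^ t"
  shows "real t \<le> q * real n / \<alpha>"
proof -
  have a: "0 < \<alpha>" using assms by linarith
  have "(1 - \<alpha>) powr (q / \<alpha>) * 1 powr (1 - q / \<alpha>) \<le> (q / \<alpha>) * (1 - \<alpha>) + (1 - q / \<alpha>) * 1"
    using assms a by (intro Youngs_inequality_0) auto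
  also have "\<dots> = 1 - q" using a by (simp add: field_simps)
  finally have "(1 - \<alpha>) powr (q / \<alpha>) \<le> 1 - q" by simp
  then have "ln ((1 - \<alpha>) powr (q / \<alpha>)) \<le> ln (1 - q)"
    using assms by (subst ln_le_cancel_iff) auto
  then have 1: "q / \<alpha> * ln (1 - \<alpha>) \<le> ln (1 - q)"
    using assms by (simp add: ln_powr)
  have "ln ((1 - q) ^ n) \<le> ln ((1 - \<alpha>) ^ t)"
    using assms by (subst ln_le_cancel_iff) auto
  then have "real n * ln (1 - q) \<le> real t * ln (1 - \<alpha>)"
    using assms by (simp add: ln_realpow)
  moreover have "real n * (q / \<alpha> * ln (1 - \<alpha>)) \<le> real n * ln (1 - q)"
    using 1 by (intro mult_left_mono) auto
  ultimately have "(q * real n / \<alpha>) * ln (1 - \<alpha>) \<le> real t * ln (1 - \<alpha>)"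
    by (simp add: mult_ac)
  moreover have "ln (1 - \<alpha>) < 0" using assms a by simp
  ultimately show ?thesis by (simp only: mult_le_cancel_right_neg)
qed

section \<open>Survival probabilities and fingerprints\<close>

definition survival :: "'a set \<Rightarrow> real \<Rightarrow> ('a set \<Rightarrow> bool) \<Rightarrow> 'a set \<Rightarrow> real" where
  "survival V q D T = bern_expect V q (\<lambda>P. of_bool (D (P \<union> T)))"

text \<open>The outcome \<open>P = {}\<close> alone contributes this much.\<close>

lemma survival_ge:
  assumes "finite V" "0 \<le> q" "q \<le> 1" "D T"
  shows "(1 - q) ^ card V \<le> survival V q D T"
proof -
  have "(1 - q) ^ card V = (\<Sum>P\<in>{{}}. q ^ card P * (1 - q) ^ card (V - P) * of_bool (D (P \<union> T)))"
    using assms by simp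
  also have "\<dots> \<le> survival V q D T"
    unfolding survival_def bern_expect_def using assms by (intro sum_mono2) auto
  finally show ?thesis .
qed

lemma survival_le_1:
  assumes "finite V" "0 \<le> q" "q \<le> 1"
  shows "survival V q D T \<le> 1"
proof -
  have "survival V q D T \<le> bern_expect V q (\<lambda>_. 1)"
    unfolding survival_def using assms by (intro bern_expect_mono) auto
  then show ?thesis using assms by (simp add: bern_expect_const)
qed

text \<open>\<open>T\<close> has maximum cardinality among the good sets, so every strictly larger
  \<open>T'\<close> inside \<open>I\<close> violates the defining inequality; this controls all
  extensions at once, not only those by one vertex.\<close>

lemma exists_fingerprint:
  assumes "finite V" "0 < q" "q \<le> \<alpha>" "\<alpha> < 1" "I \<subseteq> V" "\<And>A. A \<subseteq> I \<Longrightarrow> D A"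
  shows "\<exists>T\<subseteq>I. real (card T) \<le> q * real (card V) / \<alpha> \<and> 0 < survival V q D T \<and>
    (\<forall>T'. T \<subseteq> T' \<longrightarrow> T' \<subseteq> I \<longrightarrow>
      (1 - \<alpha>) ^ card (T' - T) * survival V q D T \<le> survival V q D T')"
proof -
  have fin: "finite I" using assms finite_subset by blast
  let ?good = "\<lambda>T. T \<subseteq> I \<and> survival V q D T \<le> (1 - \<alpha>) ^ card T"
  have "?good {}" using survival_le_1[OF assms(1)] assms by simp
  moreover have "\<forall>T. ?good T \<longrightarrow> card T \<le> card I"
    using fin card_mono by blast
  ultimately obtain T where T: "?good T" and max: "\<And>T'. ?good T' \<Longrightarrow> card T' \<le> card T"
    using ex_has_greatest_nat[of ?good "{}" card "Suc (card I)"] by (auto simp: less_Suc_eq_le)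
  have finT: "finite T" using T fin finite_subset by blast
  have lo: "(1 - q) ^ card V \<le> survival V q D T"
    using assms T by (intro survival_ge) auto
  have "0 < (1 - q) ^ card V" using assms by simp
  then have pos: "0 < survival V q D T" using lo by linarith
  have "real (card T) \<le> q * real (card V) / \<alpha>"
    using assms lo T by (intro power_le_power_imp_le_ratio) auto
  moreover have "(1 - \<alpha>) ^ card (T' - T) * survival V q D T \<le> survival V q D T'"
    if "T \<subseteq> T'" "T' \<subseteq> I" for T'
  proof (cases "T' = T")
    case False
    have finT': "finite T'" using that fin finite_subset by blast
    have "card T < card T'" using False that finT' by (simp add: psubset_card_mono psubset_eq)
    then have "\<not> ?good T'" using max[of T'] leD by blast
    then have "(1 - \<alpha>) ^ card T' \<le> survival V q D T'" using that by auto
    moreover have "card T' = card (T' - T) + card T"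
      using that finT' finT by (simp add: card_Diff_subset card_mono)
    moreover have "(1 - \<alpha>) ^ card (T' - T) * survival V q D T \<le>
        (1 - \<alpha>) ^ card (T' - T) * (1 - \<alpha>) ^ card T"
      using T assms by (intro mult_left_mono) auto
    ultimately show ?thesis by (simp add: power_add)
  qed simp
  ultimately show ?thesis using T pos by blast
qed


section \<open>The Janson functional\<close>

text \<open>The contribution to \<open>Lambda\<close> of two edges meeting in \<open>X\<close>; with
  it \<open>Lambda\<close> becomes a quadratic form in the edge weights.\<close>

definition pair_weight :: "real \<Rightarrow> 'a set \<Rightarrow> real" where
  "pair_weight p X = (\<Sum>K | K \<subseteq> X \<and> 2 \<le> card K. (1 / p) ^ card K)"

text \<open>Expand the squared degrees: a set lies in both edges exactly when it lies in their
  intersection. In this form expectations can be taken pair by pair.\<close>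

lemma Lambda_eq_pairs:
  assumes "finite V" "G \<subseteq> Pow V"
  shows "Lambda V G p \<nu> = (\<Sum>E\<in>G. \<Sum>E'\<in>G. \<nu> E * \<nu> E' * pair_weight p (E \<inter> E'))"
proof -
  have fin: "finite G" using assms finite_subset by blast
  let ?\<L> = "{L. L \<subseteq> V \<and> 2 \<le> card L}"
  have fL: "finite ?\<L>" using assms by simp
  have "Lambda V G p \<nu> = (\<Sum>L\<in>?\<L>. \<Sum>E\<in>G. \<Sum>E'\<in>G.
      \<nu> E * \<nu> E' * (of_bool (L \<subseteq> E \<inter> E') * (1 / p) ^ card L))"
    unfolding Lambda_def
  proof (rule sum.cong)
    fix L
    have "deg_nu G \<nu> L = (\<Sum>E\<in>G. of_bool (L \<subseteq> E) * \<nu> E)"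
      unfolding deg_nu_def using fin by (intro sum.mono_neutral_cong_left) auto
    then have "(deg_nu G \<nu> L)\<^sup>2 = (\<Sum>E\<in>G. \<Sum>E'\<in>G. (of_bool (L \<subseteq> E) * \<nu> E) * (of_bool (L \<subseteq> E') * \<nu> E'))"
      by (simp add: power2_eq_square sum_product)
    moreover have "p powi (- int (card L)) = (1 / p) ^ card L"
      by (simp add: power_int_minus power_one_over inverse_eq_divide)
    ultimately show "(deg_nu G \<nu> L)\<^sup>2 * p powi (- int (card L)) = (\<Sum>E\<in>G. \<Sum>E'\<in>G.
      \<nu> E * \<nu> E' * (of_bool (L \<subseteq> E \<inter> E') * (1 / p) ^ card L))"
      by (simp only: sum_distrib_right) (intro sum.cong refl, auto)
  qed simp
  also have "\<dots> = (\<Sum>E\<in>G. \<Sum>L\<in>?\<L>. \<Sum>E'\<in>G.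
      \<nu> E * \<nu> E' * (of_bool (L \<subseteq> E \<inter> E') * (1 / p) ^ card L))"
    by (rule sum.swap)
  also have "\<dots> = (\<Sum>E\<in>G. \<Sum>E'\<in>G. \<Sum>L\<in>?\<L>.
      \<nu> E * \<nu> E' * (of_bool (L \<subseteq> E \<inter> E') * (1 / p) ^ card L))"
    by (intro sum.cong refl sum.swap)
  also have "\<dots> = (\<Sum>E\<in>G. \<Sum>E'\<in>G. \<nu> E * \<nu> E' * pair_weight p (E \<inter> E'))"
  proof (intro sum.cong refl)
    fix E E' assume "E \<in> G" "E' \<in> G"
    then have "{K. K \<subseteq> E \<inter> E' \<and> 2 \<le> card K} = {L \<in> ?\<L>. L \<subseteq> E \<inter> E'}"
      using assms by auto
    then have "pair_weight p (E \<inter> E') = (\<Sum>L\<in>?\<L>. of_bool (L \<subseteq> E \<inter> E') * (1 / p) ^ card L)"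
      unfolding pair_weight_def using fL by (intro sum.mono_neutral_cong_left) auto
    then show "(\<Sum>L\<in>?\<L>. \<nu> E * \<nu> E' * (of_bool (L \<subseteq> E \<inter> E') * (1 / p) ^ card L)) =
        \<nu> E * \<nu> E' * pair_weight p (E \<inter> E')"
      by (simp only: sum_distrib_left)
  qed
  finally show ?thesis .
qed

lemma pair_weight_nonneg:
  assumes "0 < p"
  shows "0 \<le> pair_weight p X"
  unfolding pair_weight_def using assms by (intro sum_nonneg) auto

lemma pair_weight_ge:
  assumes "0 < p" "finite X" "2 \<le> card X"
  shows "(1 / p) ^ card X \<le> pair_weight p X"
  unfolding pair_weight_def
  using assms member_le_sum[of X "{K. K \<subseteq> X \<and> 2 \<le> card K}" "\<lambda>K. (1 / p) ^ card K"]
  by auto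

text \<open>
  The odds \<open>p / (q - p)\<close> are chosen so that \<open>1 + (q - p) / p = q / p\<close>: thinning by a factor
  \<open>q\<close> turns the \<open>p\<close>-weights into weights for these odds.
\<close>

lemma pair_weight_odds_le:
  assumes "0 < p" "p < q" "finite X"
  shows "pair_weight (p / (q - p)) X \<le> q ^ card X * pair_weight p X"
proof (cases "2 \<le> card X")
  case True
  \<comment> \<open>Without the size condition the sum factorises over \<open>X\<close> into
    \<open>(q / p) ^ card X\<close>, and the term \<open>K = X\<close> of
    \<open>pair_weight p X\<close> alone pays for it.\<close>
  have "pair_weight (p / (q - p)) X \<le> (\<Sum>K\<in>Pow X. ((q - p) / p) ^ card K)"
    unfolding pair_weight_def using assms by (simp, intro sum_mono2) auto
  also have "\<dots> = (\<Sum>K\<in>Pow X. (\<Prod>i\<in>K. (q - p) / p) * (\<Prod>i\<in>X - K. 1))"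
    by simp
  also have "\<dots> = (\<Prod>i\<in>X. (q - p) / p + 1)"
    using assms by (intro prod_add[symmetric])
  also have "\<dots> = q ^ card X * (1 / p) ^ card X"
    using assms by (simp add: diff_divide_distrib power_divide)
  also have "\<dots> \<le> q ^ card X * pair_weight p X"
    using assms True by (intro mult_left_mono pair_weight_ge) auto
  finally show ?thesis .
next
  case False
  then have "\<not> 2 \<le> card K" if "K \<subseteq> X" for K
    using card_mono[OF assms(3) that] by simp
  then have "{K. K \<subseteq> X \<and> 2 \<le> card K} = {}" by blast
  then show ?thesis by (simp only: pair_weight_def) simp
qed

lemma Lambda_nonneg:
  assumes "0 < p"
  shows "0 \<le> Lambda V G p \<nu>"
  unfolding Lambda_def using assms by (intro sum_nonneg) auto

lemma Lambda_mono:
  assumes "0 < p" "finite G'" "G \<subseteq> G'" "\<forall>E\<in>G'. 0 \<le> \<nu> E"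
  shows "Lambda V G p \<nu> \<le> Lambda V G' p \<nu>"
  unfolding Lambda_def
proof (intro sum_mono mult_right_mono power_mono)
  fix L
  show "deg_nu G \<nu> L \<le> deg_nu G' \<nu> L"
    unfolding deg_nu_def using assms by (intro sum_mono2) auto
  show "0 \<le> deg_nu G \<nu> L"
    unfolding deg_nu_def using assms by (intro sum_nonneg) auto
  show "0 \<le> p powi (- int (card L))"
    using assms by simp
qed

text \<open>Extending the weights by zero changes neither the mass nor any degree.\<close>

lemma janson_mono:
  assumes "finite G'" "G \<subseteq> G'" "janson V G p R"
  shows "janson V G' p R"
proof -
  obtain \<nu> where \<nu>: "\<forall>E\<in>G. 0 \<le> \<nu> E" "Lambda V G p \<nu> < (e_nu G \<nu>)\<^sup>2 / R"
    using assms(3) unfolding janson_def by blast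
  let ?\<nu> = "\<lambda>E. if E \<in> G then \<nu> E else 0"
  have "e_nu G' ?\<nu> = e_nu G \<nu>"
    unfolding e_nu_def using assms by (intro sum.mono_neutral_cong_right) auto
  moreover have "deg_nu G' ?\<nu> L = deg_nu G \<nu> L" for L
    unfolding deg_nu_def using assms by (intro sum.mono_neutral_cong_right) auto
  then have "Lambda V G' p ?\<nu> = Lambda V G p \<nu>"
    by (simp add: Lambda_def)
  ultimately show ?thesis
    unfolding janson_def using \<nu> by (intro exI[of _ ?\<nu>]) auto
qed

text \<open>The factor 4: squaring a sum of two masses costs 2, and adding two bounds by the same
  \<open>Lambda\<close> costs another 2. Using \<open>G' - G\<close> counts common edges
  once.\<close>

lemma not_janson_union:
  assumes "finite G" "finite G'" "0 < p" "0 < R"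
    and "\<not> janson V G p (R / 4)" "\<not> janson V G' p (R / 4)"
  shows "\<not> janson V (G \<union> G') p R"
proof
  assume "janson V (G \<union> G') p R"
  then obtain \<nu> where \<nu>: "\<forall>E\<in>G \<union> G'. 0 \<le> \<nu> E"
      "Lambda V (G \<union> G') p \<nu> < (e_nu (G \<union> G') \<nu>)\<^sup>2 / R"
    unfolding janson_def by blast
  have le: "(e_nu F \<nu>)\<^sup>2 \<le> R / 4 * Lambda V (G \<union> G') p \<nu>"
    if F: "F \<subseteq> G \<union> G'" "\<not> janson V F p (R / 4)" for F
  proof -
    have "(e_nu F \<nu>)\<^sup>2 / (R / 4) \<le> Lambda V F p \<nu>"
      using F \<nu>(1) unfolding janson_def by (meson not_less subset_iff)
    also have "\<dots> \<le> Lambda V (G \<union> G') p \<nu>"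
      using assms F \<nu>(1) by (intro Lambda_mono) auto
    finally show ?thesis using assms(4) by (simp add: field_simps)
  qed
  have "\<not> janson V (G' - G) p (R / 4)"
    using janson_mono[OF assms(2), of "G' - G"] assms(6) by blast
  then have "(e_nu G \<nu>)\<^sup>2 \<le> R / 4 * Lambda V (G \<union> G') p \<nu>"
      "(e_nu (G' - G) \<nu>)\<^sup>2 \<le> R / 4 * Lambda V (G \<union> G') p \<nu>"
    using le assms(5) by blast+
  moreover have "(e_nu (G \<union> G') \<nu>)\<^sup>2 \<le> 2 * (e_nu G \<nu>)\<^sup>2 + 2 * (e_nu (G' - G) \<nu>)\<^sup>2"
  proof -
    have "e_nu (G \<union> G') \<nu> = e_nu G \<nu> + e_nu (G' - G) \<nu>"
      unfolding e_nu_def using assms(1,2) sum.union_disjoint[of G "G' - G" \<nu>] by auto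
    moreover have "(a + b)\<^sup>2 \<le> 2 * a\<^sup>2 + 2 * b\<^sup>2" for a b :: real
      using zero_le_power2[of "a - b"] by (simp add: power2_eq_square algebra_simps)
    ultimately show ?thesis by simp
  qed
  ultimately have "(e_nu (G \<union> G') \<nu>)\<^sup>2 \<le> R * Lambda V (G \<union> G') p \<nu>"
    by simp
  then show False using \<nu>(2) assms(4) by (simp add: field_simps)
qed

section \<open>Containers\<close>

lemma survival_forced:
  assumes "finite V" "A \<subseteq> V"
  shows "bern_expect V q (\<lambda>P. of_bool (A \<subseteq> P) * of_bool (D (P \<union> T))) =
    q ^ card A * survival V q D (T \<union> A)"
  unfolding survival_def using bern_expect_forced[OF assms(1,2)]
  by (simp add: Un_ac)

text \<open>Second moment method conditioned on \<open>D\<close>. Averaging gives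
  \<open>\<kappa>\<^sup>2 \<le> \<eta> * R * Lambda V F p \<nu>\<close>. If \<open>F\<close> were
  Janson, the right side would be below \<open>4 * \<eta> * e\<^sup>2\<close>, which the bound on
  \<open>\<eta>\<close> makes at most \<open>\<kappa>\<^sup>2\<close>.\<close>

lemma dense_edges_not_janson:
  fixes \<alpha> :: real
  assumes "finite V" "H \<subseteq> Pow V" "\<forall>E\<in>H. card E \<le> s"
    and "0 < p" "p < q" "q \<le> 1" "0 < \<alpha>" "\<alpha> < 1" "0 < R" "0 < \<eta>" "\<eta> \<le> (1 - \<alpha>) ^ (2 * s) / 4"
    and "T \<subseteq> V"
    and D_def: "\<And>A. D A \<longleftrightarrow> \<not> janson V (induced H A) (p / (q - p)) (\<eta> * R)"
    and pos: "0 < survival V q D T"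
    and F_def: "F = {E \<in> H. (1 - \<alpha>) ^ card (E - T) * survival V q D T \<le> survival V q D (T \<union> E)}"
  shows "\<not> janson V F p (R / 4)"
proof
  assume "janson V F p (R / 4)"
  then obtain \<nu> where nonneg: "\<And>E. E \<in> F \<Longrightarrow> 0 \<le> \<nu> E"
      and small: "Lambda V F p \<nu> < (e_nu F \<nu>)\<^sup>2 / (R / 4)"
    unfolding janson_def by blast
  define e where "e = e_nu F \<nu>"
  define w where "w = survival V q D T"
  define p' where "p' = p / (q - p)"
  \<comment> \<open>A lower bound for the mean of \<open>eP\<close> conditioned on
    \<open>D\<close>.\<close>
  define \<kappa> where "\<kappa> = (1 - \<alpha>) ^ s * e"
  \<comment> \<open>Inverse probability weights: an edge \<open>E\<close> of \<open>F\<close> lies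
    in \<open>P \<union> T\<close> with probability \<open>q ^ card (E - T)\<close>, so its expected
    weight is \<open>\<nu> E\<close>.\<close>
  define \<mu> where "\<mu> = (\<lambda>E. if E \<in> F then \<nu> E * (1 / q) ^ card (E - T) else 0)"
  define eP where "eP = (\<lambda>P. \<Sum>E\<in>F. of_bool (E - T \<subseteq> P) * \<mu> E)"
  define \<Lambda>P where "\<Lambda>P = (\<lambda>P. \<Sum>E\<in>F. \<Sum>E'\<in>F. of_bool (E \<union> E' - T \<subseteq> P) *
    (\<mu> E * \<mu> E' * pair_weight p' (E \<inter> E')))"
  have q: "0 < q" using assms by linarith
  have p': "0 < p'" using assms by (simp add: p'_def)
  have finH: "finite H" using assms finite_subset by blast
  have FH: "F \<subseteq> H" by (auto simp: F_def)
  have finF: "finite F" using FH finH finite_subset by blast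
  have FV: "E \<subseteq> V" "finite E" if "E \<in> F" for E
    using that FH assms(1,2) by (auto intro: finite_subset)
  have e0: "0 \<le> e" unfolding e_def e_nu_def using nonneg by (intro sum_nonneg) auto
  have \<mu>0: "0 \<le> \<mu> E" for E using nonneg q by (simp add: \<mu>_def)
  have w0: "0 < w" using pos by (simp add: w_def)
  have monoD: "D A" if "A \<subseteq> B" "D B" for A B
  proof -
    have "induced H A \<subseteq> induced H B" "finite (induced H B)"
      using that finH by (auto simp: induced_def)
    then show ?thesis using that(2) janson_mono unfolding D_def by blast
  qed
  have eP_eq: "e_nu (induced H (P \<union> T)) \<mu> = eP P" for P
  proof -
    have "e_nu (induced H (P \<union> T)) \<mu> = (\<Sum>E\<in>H. of_bool (E \<subseteq> P \<union> T) * \<mu> E)"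
      unfolding e_nu_def induced_def using finH by (intro sum.mono_neutral_cong_left) auto
    also have "\<dots> = eP P"
      unfolding eP_def using finH FH by (intro sum.mono_neutral_cong_right) (auto simp: \<mu>_def)
    finally show ?thesis .
  qed
  have \<Lambda>P_eq: "Lambda V (induced H (P \<union> T)) p' \<mu> = \<Lambda>P P" for P
  proof -
    let ?G = "induced H (P \<union> T)"
    have G: "?G \<subseteq> H" "finite ?G" using finH by (auto simp: induced_def)
    have "Lambda V ?G p' \<mu> = (\<Sum>E\<in>?G. \<Sum>E'\<in>?G. \<mu> E * \<mu> E' * pair_weight p' (E \<inter> E'))"
      using G assms(1,2) by (intro Lambda_eq_pairs) auto
    also have "\<dots> = (\<Sum>(E, E')\<in>?G \<times> ?G. \<mu> E * \<mu> E' * pair_weight p' (E \<inter> E'))"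
      by (rule sum.cartesian_product)
    \<comment> \<open>Both index squares embed in the union: off the first the indicator vanishes,
      off the second \<open>\<mu>\<close> does.\<close>
    also have "\<dots> = (\<Sum>(E, E')\<in>?G \<times> ?G \<union> F \<times> F. of_bool (E \<union> E' - T \<subseteq> P) *
        (\<mu> E * \<mu> E' * pair_weight p' (E \<inter> E')))"
      using G finF FH by (intro sum.mono_neutral_cong_left) (auto simp: induced_def \<mu>_def)
    also have "\<dots> = (\<Sum>(E, E')\<in>F \<times> F. of_bool (E \<union> E' - T \<subseteq> P) *
        (\<mu> E * \<mu> E' * pair_weight p' (E \<inter> E')))"
      using G finF by (intro sum.mono_neutral_right) (auto simp: \<mu>_def split: if_splits)
    also have "\<dots> = \<Lambda>P P" unfolding \<Lambda>P_def by (rule sum.cartesian_product[symmetric])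
    finally show ?thesis .
  qed
  \<comment> \<open>On \<open>D\<close> the failure of the Janson property bounds
    \<open>(eP P)\<^sup>2\<close>. Replacing the square by its tangent at \<open>\<kappa>\<close>
    leaves an inequality linear in \<open>eP\<close>, so its mean suffices.\<close>
  have pointwise: "2 * \<kappa> * (eP P * of_bool (D (P \<union> T))) - \<kappa>\<^sup>2 * of_bool (D (P \<union> T)) \<le>
      \<eta> * R * (\<Lambda>P P * of_bool (D (P \<union> T)))" for P
  proof (cases "D (P \<union> T)")
    case True
    then have "(eP P)\<^sup>2 / (\<eta> * R) \<le> \<Lambda>P P"
      unfolding D_def janson_def p'_def[symmetric] using \<mu>0 eP_eq \<Lambda>P_eq by (metis not_less)
    then have "(eP P)\<^sup>2 \<le> \<eta> * R * \<Lambda>P P" using assms by (simp add: field_simps)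
    moreover have "0 \<le> (eP P - \<kappa>)\<^sup>2" by simp
    ultimately show ?thesis using True by (simp add: power2_eq_square algebra_simps)
  qed simp
  have "bern_expect V q (\<lambda>P. eP P * of_bool (D (P \<union> T))) =
      (\<Sum>E\<in>F. \<mu> E * bern_expect V q (\<lambda>P. of_bool (E - T \<subseteq> P) * of_bool (D (P \<union> T))))"
    unfolding eP_def sum_distrib_right bern_expect_sum
    by (simp add: bern_expect_cmult[symmetric] mult_ac)
  also have "\<dots> = (\<Sum>E\<in>F. \<nu> E * survival V q D (T \<union> E))"
  proof (rule sum.cong)
    fix E assume E: "E \<in> F"
    have "E - T \<subseteq> V" using FV[OF E] by blast
    then show "\<mu> E * bern_expect V q (\<lambda>P. of_bool (E - T \<subseteq> P) * of_bool (D (P \<union> T))) =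
        \<nu> E * survival V q D (T \<union> E)"
      using E q assms(1) by (subst survival_forced) (auto simp: \<mu>_def power_divide)
  qed simp
  also have "\<dots> \<ge> (\<Sum>E\<in>F. \<nu> E * ((1 - \<alpha>) ^ s * w))"
  proof (intro sum_mono mult_left_mono nonneg)
    fix E assume E: "E \<in> F"
    have "card (E - T) \<le> card E" using FV[OF E] by (intro card_mono) auto
    then have "card (E - T) \<le> s" using E FH assms(3) by force
    then have "(1 - \<alpha>) ^ s * w \<le> (1 - \<alpha>) ^ card (E - T) * w"
      using assms w0 by (intro mult_right_mono power_decreasing) auto
    also have "\<dots> \<le> survival V q D (T \<union> E)" using E by (simp add: F_def w_def)
    finally show "(1 - \<alpha>) ^ s * w \<le> survival V q D (T \<union> E)" .
  qed
  finally have first: "\<kappa> * w \<le> bern_expect V q (\<lambda>P. eP P * of_bool (D (P \<union> T)))"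
    by (simp add: \<kappa>_def e_def e_nu_def sum_distrib_right sum_distrib_left mult_ac)
  have "bern_expect V q \<Lambda>P = (\<Sum>E\<in>F. \<Sum>E'\<in>F. (\<mu> E * \<mu> E' * pair_weight p' (E \<inter> E')) *
      bern_expect V q (\<lambda>P. of_bool (E \<union> E' - T \<subseteq> P)))"
    unfolding \<Lambda>P_def bern_expect_sum by (simp add: bern_expect_cmult[symmetric] mult_ac)
  \<comment> \<open>The overlap of a pair leaves a surplus of at most
    \<open>(1 / q) ^ card (E \<inter> E')\<close>, which the passage between \<open>p\<close> and
    the odds \<open>p'\<close> cancels.\<close>
  also have "\<dots> \<le> (\<Sum>E\<in>F. \<Sum>E'\<in>F. \<nu> E * \<nu> E' * pair_weight p (E \<inter> E'))"
  proof (intro sum_mono)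
    fix E E' assume E: "E \<in> F" "E' \<in> F"
    have fin: "finite (E - T)" "finite (E' - T)" "finite (E \<inter> E')" using FV E by auto
    have "card (E - T) + card (E' - T) = card (E \<union> E' - T) + card (E \<inter> E' - T)"
      using card_Un_Int[OF fin(1,2)] by (simp add: Un_Diff Int_Diff Diff_Int_distrib2 inf_commute Int_absorb2 Diff_Int2)
    then have "(1 / q) ^ card (E - T) * (1 / q) ^ card (E' - T) =
        (1 / q) ^ card (E \<union> E' - T) * (1 / q) ^ card (E \<inter> E' - T)"
      by (simp only: power_add[symmetric])
    then have "(1 / q) ^ card (E - T) * (1 / q) ^ card (E' - T) * q ^ card (E \<union> E' - T) =
        (1 / q) ^ card (E \<inter> E' - T)"
      using q by (simp add: power_divide)
    also have "\<dots> \<le> (1 / q) ^ card (E \<inter> E')"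
      using q assms fin by (intro power_increasing card_mono) auto
    finally have 1: "(1 / q) ^ card (E - T) * (1 / q) ^ card (E' - T) * q ^ card (E \<union> E' - T) \<le>
        (1 / q) ^ card (E \<inter> E')" .
    have "(\<mu> E * \<mu> E' * pair_weight p' (E \<inter> E')) * bern_expect V q (\<lambda>P. of_bool (E \<union> E' - T \<subseteq> P)) =
        (\<nu> E * \<nu> E' * pair_weight p' (E \<inter> E')) *
        ((1 / q) ^ card (E - T) * (1 / q) ^ card (E' - T) * q ^ card (E \<union> E' - T))"
      using E FV assms(1) by (subst bern_expect_subset) (auto simp: \<mu>_def)
    also have "\<dots> \<le> (\<nu> E * \<nu> E' * pair_weight p' (E \<inter> E')) * (1 / q) ^ card (E \<inter> E')"
      using E nonneg p' by (intro mult_left_mono[OF 1] mult_nonneg_nonneg pair_weight_nonneg) auto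
    also have "\<dots> \<le> (\<nu> E * \<nu> E' * (q ^ card (E \<inter> E') * pair_weight p (E \<inter> E'))) * (1 / q) ^ card (E \<inter> E')"
      unfolding p'_def using E nonneg q assms fin
      by (intro mult_right_mono mult_left_mono pair_weight_odds_le) auto
    also have "\<dots> = \<nu> E * \<nu> E' * pair_weight p (E \<inter> E')"
      using q by (simp add: power_divide)
    finally show "(\<mu> E * \<mu> E' * pair_weight p' (E \<inter> E')) * bern_expect V q (\<lambda>P. of_bool (E \<union> E' - T \<subseteq> P)) \<le>
        \<nu> E * \<nu> E' * pair_weight p (E \<inter> E')" .
  qed
  also have "\<dots> = Lambda V F p \<nu>"
    using assms(1,2) FH by (intro Lambda_eq_pairs[symmetric]) auto
  finally have "bern_expect V q \<Lambda>P \<le> Lambda V F p \<nu>" .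
  moreover have "bern_expect V q (\<lambda>P. \<Lambda>P P * of_bool (D (P \<union> T))) \<le>
      bern_expect V q \<Lambda>P * bern_expect V q (\<lambda>P. of_bool (D (P \<union> T)))"
  proof (rule bern_expect_harris[OF assms(1)])
    fix A B :: "'a set" assume "A \<subseteq> B"
    then show "\<Lambda>P A \<le> \<Lambda>P B"
      unfolding \<Lambda>P_def using \<mu>0 p'
      by (intro sum_mono mult_right_mono mult_nonneg_nonneg pair_weight_nonneg) auto
    show "of_bool (D (B \<union> T)) \<le> (of_bool (D (A \<union> T)) :: real)"
      using monoD[of "A \<union> T" "B \<union> T"] \<open>A \<subseteq> B\<close> by auto
  qed (use q assms in auto)
  ultimately have second: "bern_expect V q (\<lambda>P. \<Lambda>P P * of_bool (D (P \<union> T))) \<le> Lambda V F p \<nu> * w"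
    using w0 unfolding w_def survival_def by (smt (verit) mult_right_mono)
  have "bern_expect V q (\<lambda>P. 2 * \<kappa> * (eP P * of_bool (D (P \<union> T))) - \<kappa>\<^sup>2 * of_bool (D (P \<union> T))) \<le>
      bern_expect V q (\<lambda>P. \<eta> * R * (\<Lambda>P P * of_bool (D (P \<union> T))))"
    using q assms pointwise by (intro bern_expect_mono) auto
  then have "2 * \<kappa> * bern_expect V q (\<lambda>P. eP P * of_bool (D (P \<union> T))) - \<kappa>\<^sup>2 * w \<le>
      \<eta> * R * bern_expect V q (\<lambda>P. \<Lambda>P P * of_bool (D (P \<union> T)))"
    by (simp only: bern_expect_diff bern_expect_cmult w_def survival_def)
  also have "\<dots> \<le> \<eta> * R * (Lambda V F p \<nu> * w)"
    using second assms by (intro mult_left_mono) auto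
  finally have "2 * \<kappa> * bern_expect V q (\<lambda>P. eP P * of_bool (D (P \<union> T))) \<le>
      \<kappa>\<^sup>2 * w + \<eta> * R * (Lambda V F p \<nu> * w)" by simp
  moreover have "2 * \<kappa> * (\<kappa> * w) \<le> 2 * \<kappa> * bern_expect V q (\<lambda>P. eP P * of_bool (D (P \<union> T)))"
    using first e0 assms by (intro mult_left_mono) (auto simp: \<kappa>_def)
  ultimately have "\<kappa>\<^sup>2 * w \<le> (\<eta> * R * Lambda V F p \<nu>) * w"
    by (simp add: power2_eq_square algebra_simps)
  then have "\<kappa>\<^sup>2 \<le> \<eta> * R * Lambda V F p \<nu>" using w0 by simp
  also have "\<dots> < \<eta> * R * (e\<^sup>2 / (R / 4))"
    using small assms by (intro mult_strict_left_mono) (auto simp: e_def)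
  also have "\<dots> = 4 * \<eta> * e\<^sup>2" using assms by simp
  also have "\<dots> \<le> (1 - \<alpha>) ^ (2 * s) * e\<^sup>2"
    using assms by (intro mult_right_mono) auto
  also have "\<dots> = \<kappa>\<^sup>2" by (simp add: \<kappa>_def power_mult_distrib power_mult[symmetric] mult.commute)
  finally show False by simp
qed

section \<open>Second round: revealing edges up to a missing vertex\<close>

text \<open>The summand at \<open>v\<close> is the drop of
  \<open>(1 / p) ^ card Y * of_bool (Y \<subseteq> P)\<close> when the initial segment
  \<open>Y\<close> absorbs \<open>v\<close>, so only the two ends survive. When \<open>P\<close>
  misses a vertex of \<open>X\<close> the sum is exactly 1.\<close>

lemma telescope_first_missing:
  fixes \<phi> :: "'a \<Rightarrow> nat" and p :: real
  assumes "finite X" "inj_on \<phi> X"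
  shows "(\<Sum>v\<in>X. (1 / p) ^ card {u \<in> X. \<phi> u < \<phi> v} * of_bool ({u \<in> X. \<phi> u < \<phi> v} \<subseteq> P) *
      (1 - of_bool (v \<in> P) / p)) = 1 - (1 / p) ^ card X * of_bool (X \<subseteq> P)"
  using assms
proof (induction X rule: finite_ranking_induct[where f = \<phi>])
  case empty
  then show ?case by simp
next
  case (insert x X)
  show ?case
  \<comment> \<open>The ranking induction admits an \<open>x\<close> already present; for a new one,
    injectivity makes the order strict.\<close>
  proof (cases "x \<in> X")
    case True
    then show ?thesis using insert by (simp add: insert_absorb)
  next
    case False
    have less: "\<phi> y < \<phi> x" if "y \<in> X" for y
      using insert.hyps(2)[OF that] inj_onD[OF insert.prems, of y x] that False by fastforce
    have "{u \<in> insert x X. \<phi> u < \<phi> x} = X" using less by auto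
    moreover have "{u \<in> insert x X. \<phi> u < \<phi> v} = {u \<in> X. \<phi> u < \<phi> v}" if "v \<in> X" for v
      using less[OF that] by auto
    moreover have "inj_on \<phi> X" using insert.prems by simp
    ultimately show ?thesis
      using insert.IH insert.hyps(1) False by (auto simp: algebra_simps)
  qed
qed

text \<open>Adding \<open>v\<close> to its nonempty segment gives a set of at least two elements
  whose weight has one more factor \<open>1 / p\<close>, and distinct \<open>v\<close> give distinct
  sets.\<close>

lemma initial_segments_weight_le:
  fixes \<phi> :: "'a \<Rightarrow> nat"
  assumes "finite X" "inj_on \<phi> X" "0 < p"
  shows "(\<Sum>v\<in>X. of_bool ({u \<in> X. \<phi> u < \<phi> v} \<noteq> {}) * (1 / p) ^ card {u \<in> X. \<phi> u < \<phi> v})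
    \<le> p * pair_weight p X"
proof -
  define Y where "Y = {v \<in> X. {u \<in> X. \<phi> u < \<phi> v} \<noteq> {}}"
  define K where "K v = {u \<in> X. \<phi> u \<le> \<phi> v}" for v
  have K: "K v = insert v {u \<in> X. \<phi> u < \<phi> v}" if "v \<in> X" for v
    using that assms(2) by (auto simp: K_def le_less dest: inj_onD)
  have cK: "card (K v) = Suc (card {u \<in> X. \<phi> u < \<phi> v})" if "v \<in> X" for v
    using K[OF that] assms(1) by simp
  have "inj_on K Y"
  proof (rule inj_onI)
    fix v w assume "v \<in> Y" "w \<in> Y" "K v = K w"
    then have "v \<in> K w" "w \<in> K v" "v \<in> X" "w \<in> X" by (auto simp: Y_def K_def)
    then show "v = w" using assms(2) by (auto simp: K_def dest: inj_onD)
  qed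
  have "(\<Sum>v\<in>X. of_bool ({u \<in> X. \<phi> u < \<phi> v} \<noteq> {}) * (1 / p) ^ card {u \<in> X. \<phi> u < \<phi> v}) =
      (\<Sum>v\<in>Y. (1 / p) ^ card {u \<in> X. \<phi> u < \<phi> v})"
    unfolding Y_def using assms(1) by (intro sum.mono_neutral_cong_right) auto
  also have "\<dots> = (\<Sum>v\<in>Y. p * (1 / p) ^ card (K v))"
    using assms(3) cK by (intro sum.cong) (auto simp: Y_def)
  also have "\<dots> = p * (\<Sum>L\<in>K ` Y. (1 / p) ^ card L)"
    using \<open>inj_on K Y\<close> by (simp add: sum.reindex sum_distrib_left)
  also have "\<dots> \<le> p * pair_weight p X"
    unfolding pair_weight_def
  proof (intro mult_left_mono sum_mono2)
    show "K ` Y \<subseteq> {L. L \<subseteq> X \<and> 2 \<le> card L}"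
    proof clarsimp
      fix v assume v: "v \<in> Y"
      then have "v \<in> X" by (simp add: Y_def)
      have "0 < card {u \<in> X. \<phi> u < \<phi> v}"
        using v assms(1) unfolding Y_def card_gt_0_iff by auto
      then show "K v \<subseteq> X \<and> 2 \<le> card (K v)"
        using cK[OF \<open>v \<in> X\<close>] by (auto simp: K_def)
    qed
  qed (use assms in auto)
  finally show ?thesis .
qed

text \<open>The event \<open>v \<in> P\<close> has probability \<open>p\<close>, which cancels
  \<open>1 / p\<close>, and \<open>A\<close> does not depend on \<open>v\<close>. For the indicator
  \<open>g\<close> of a decreasing property, the difference on the right detects that
  \<open>v\<close> is pivotal.\<close>

lemma bern_expect_pivotal:
  assumes "finite V" "v \<in> V" "p \<noteq> 0" "\<And>P. A (insert v P) = A P"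
  shows "bern_expect V p (\<lambda>P. g P * (A P * (1 - of_bool (v \<in> P) / p))) =
    bern_expect V p (\<lambda>P. (g P - g (insert v P)) * A P)"
proof -
  have "bern_expect V p (\<lambda>P. g P * (A P * (1 - of_bool (v \<in> P) / p))) =
      bern_expect V p (\<lambda>P. g P * A P - (1 / p) * (of_bool (v \<in> P) * (g P * A P)))"
    by (simp add: algebra_simps)
  also have "\<dots> = bern_expect V p (\<lambda>P. g P * A P) - bern_expect V p (\<lambda>P. g (insert v P) * A P)"
    unfolding bern_expect_diff bern_expect_cmult bern_expect_forced_vertex[OF assms(1,2)]
    using assms(3,4) by simp
  finally show ?thesis by (simp add: bern_expect_diff left_diff_distrib)
qed

text \<open>The normalised indicators of a pair have mean product
  \<open>(1 / p) ^ card (l E \<inter> l E')\<close>, so disjoint pairs cancel against the squared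
  mean. Allowing a larger set \<open>m E E'\<close> lets the application put vertices of the
  fingerprint back.\<close>

lemma bern_variance_le:
  assumes "finite V" "finite G" "0 < p" "p \<le> 1"
    and "\<And>E. E \<in> G \<Longrightarrow> 0 \<le> c E" "\<And>E. E \<in> G \<Longrightarrow> l E \<subseteq> V"
    and "\<And>E E'. E \<in> G \<Longrightarrow> E' \<in> G \<Longrightarrow> l E \<inter> l E' \<subseteq> m E E'" "\<And>E E'. E \<in> G \<Longrightarrow> finite (m E E')"
  shows "bern_expect V p (\<lambda>P. (\<Sum>E\<in>G. c E * (1 / p) ^ card (l E) * of_bool (l E \<subseteq> P))\<^sup>2) - (\<Sum>E\<in>G. c E)\<^sup>2
    \<le> (\<Sum>E\<in>G. \<Sum>E'\<in>G. c E * c E' * (of_bool (m E E' \<noteq> {}) * (1 / p) ^ card (m E E')))"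
proof -
  have "bern_expect V p (\<lambda>P. (\<Sum>E\<in>G. c E * (1 / p) ^ card (l E) * of_bool (l E \<subseteq> P))\<^sup>2) =
      bern_expect V p (\<lambda>P. \<Sum>E\<in>G. \<Sum>E'\<in>G. (c E * c E' * (1 / p) ^ (card (l E) + card (l E'))) *
        of_bool (l E \<union> l E' \<subseteq> P))"
    by (simp add: power2_eq_square sum_product power_add mult_ac of_bool_conj)
  also have "\<dots> = (\<Sum>E\<in>G. \<Sum>E'\<in>G. (c E * c E' * (1 / p) ^ (card (l E) + card (l E'))) *
        bern_expect V p (\<lambda>P. of_bool (l E \<union> l E' \<subseteq> P)))"
    by (simp only: bern_expect_sum bern_expect_cmult)
  also have "\<dots> = (\<Sum>E\<in>G. \<Sum>E'\<in>G. c E * c E' * (1 / p) ^ card (l E \<inter> l E'))"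
  proof (intro sum.cong refl)
    fix E E' assume E: "E \<in> G" "E' \<in> G"
    have fin: "finite (l E)" "finite (l E')"
      using assms(1,6) E by (auto intro: finite_subset)
    have "l E \<union> l E' \<subseteq> V" using assms(6) E by blast
    then show "(c E * c E' * (1 / p) ^ (card (l E) + card (l E'))) *
        bern_expect V p (\<lambda>P. of_bool (l E \<union> l E' \<subseteq> P)) = c E * c E' * (1 / p) ^ card (l E \<inter> l E')"
      unfolding bern_expect_subset[OF assms(1) \<open>l E \<union> l E' \<subseteq> V\<close>] card_Un_Int[OF fin]
      using assms(3) by (simp add: power_add power_divide)
  qed
  finally have "bern_expect V p (\<lambda>P. (\<Sum>E\<in>G. c E * (1 / p) ^ card (l E) * of_bool (l E \<subseteq> P))\<^sup>2) -
      (\<Sum>E\<in>G. c E)\<^sup>2 = (\<Sum>E\<in>G. \<Sum>E'\<in>G. c E * c E' * ((1 / p) ^ card (l E \<inter> l E') - 1))"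
    by (simp add: power2_eq_square sum_product sum_subtractf right_diff_distrib)
  also have "\<dots> \<le> (\<Sum>E\<in>G. \<Sum>E'\<in>G. c E * c E' * (of_bool (m E E' \<noteq> {}) * (1 / p) ^ card (m E E')))"
  proof (intro sum_mono mult_left_mono mult_nonneg_nonneg assms(5))
    fix E E' assume E: "E \<in> G" "E' \<in> G"
    show "(1 / p) ^ card (l E \<inter> l E') - 1 \<le> of_bool (m E E' \<noteq> {}) * (1 / p) ^ card (m E E')"
    proof (cases "m E E' = {}")
      case True
      then have "l E \<inter> l E' = {}" using assms(7)[OF E] by blast
      then show ?thesis using True by simp
    next
      case False
      have "(1 / p) ^ card (l E \<inter> l E') \<le> (1 / p) ^ card (m E E')"
        using assms E by (intro power_increasing card_mono) auto
      then show ?thesis using False by simp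
    qed
  qed
  finally show ?thesis .
qed

text \<open>On \<open>D\<close> the telescoping identity recovers the whole mass \<open>e\<close>.
  Its mean is bounded by three terms, coming from the degrees, the constant in AM-GM and the
  variance; each is at most \<open>e / 4\<close>, a contradiction.\<close>

lemma container_not_janson:
  assumes "finite V" "V \<noteq> {}" "G \<subseteq> Pow V" "\<forall>E\<in>G. card E \<le> s"
    and "0 < p" "p \<le> 1" "0 < \<delta>" "\<delta> * real s \<le> 1 / 4" "2 ^ 10 * \<delta> \<le> 1"
    and "0 < R" "p * real (card V) \<le> 2 ^ 8 * R"
    and D_def: "\<And>A. D A \<longleftrightarrow> (\<forall>E\<in>G. \<not> E \<subseteq> A)"
    and pos: "0 < survival V p D S"
    and "C \<subseteq> V" and C: "\<And>v. v \<in> C \<Longrightarrow> (1 - \<delta>) * survival V p D S \<le> survival V p D (insert v S)"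
  shows "\<not> janson V (induced G C) p R"
proof
  let ?G = "induced G C"
  assume "janson V ?G p R"
  then obtain \<nu> where nonneg: "\<And>E. E \<in> ?G \<Longrightarrow> 0 \<le> \<nu> E"
      and small: "Lambda V ?G p \<nu> < (e_nu ?G \<nu>)\<^sup>2 / R"
    unfolding janson_def by blast
  obtain \<phi> :: "'a \<Rightarrow> nat" where \<phi>: "inj_on \<phi> V"
    using assms(1) finite_imp_inj_to_nat_seg by blast
  define n where "n = real (card V)"
  define e where "e = e_nu ?G \<nu>"
  define w where "w = survival V p D S"
  \<comment> \<open>Balances the last two error terms: one is controlled by
    \<open>2 ^ 10 * \<delta> \<le> 1\<close>, the other by the bound on
    \<open>p * real (card V)\<close>.\<close>
  define t where "t = n / (2 ^ 10 * e)"
  define l where "l E v = {u \<in> E - S. \<phi> u < \<phi> v}" for E v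
  define c where "c v E = of_bool (v \<in> E - S) * \<nu> E" for v E
  define d where "d v = (\<Sum>E\<in>?G. c v E)" for v
  \<comment> \<open>Normalised weight of the edges through \<open>v\<close> whose earlier vertices
    outside \<open>S\<close> are all selected; its mean is \<open>d v\<close>.\<close>
  define A where "A v P = (\<Sum>E\<in>?G. c v E * (1 / p) ^ card (l E v) * of_bool (l E v \<subseteq> P))" for v P
  define g where "g P = (of_bool (D (P \<union> S)) :: real)" for P
  define B where "B v P = (max 0 (A v P - d v))\<^sup>2" for v P
  define m where "m E E' v = {u \<in> E \<inter> E'. \<phi> u < \<phi> v}" for E E' v
  have finG: "finite ?G" "?G \<subseteq> Pow V"
    using assms(1,3) by (auto simp: induced_def intro: finite_subset)
  have GV: "E \<subseteq> V" "E \<subseteq> C" "finite E" "card E \<le> s" if "E \<in> ?G" for E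
    using that assms(1,3,4) by (auto simp: induced_def intro: finite_subset)
  have n0: "0 < n" using assms(1,2) by (simp add: n_def card_gt_0_iff)
  have w0: "0 < w" using pos by (simp add: w_def)
  have c0: "0 \<le> c v E" if "E \<in> ?G" for v E
    using nonneg[OF that] by (simp add: c_def)
  have "0 < (e_nu ?G \<nu>)\<^sup>2 / R"
    using small Lambda_nonneg[OF assms(5), of V ?G \<nu>] by linarith
  then have "e \<noteq> 0" using assms(10) by (auto simp: e_def)
  moreover have "0 \<le> e" unfolding e_def e_nu_def using nonneg by (intro sum_nonneg) auto
  ultimately have e0: "0 < e" by simp
  have t0: "0 < t" using n0 e0 by (simp add: t_def)
  have monoD: "D X" if "X \<subseteq> Y" "D Y" for X Y
    using that unfolding D_def by blast
  have A_mono: "A v P \<le> A v Q" if "P \<subseteq> Q" for v P Q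
    unfolding A_def using that c0 assms(5)
    by (intro sum_mono mult_left_mono mult_nonneg_nonneg) auto
  have A_insert: "A v (insert v P) = A v P" for v P
  proof -
    have "l E v \<subseteq> insert v P \<longleftrightarrow> l E v \<subseteq> P" for E
      by (auto simp: l_def)
    then show ?thesis by (simp add: A_def)
  qed
  have expect_A: "bern_expect V p (A v) = d v" for v
  proof -
    have "bern_expect V p (A v) =
        (\<Sum>E\<in>?G. c v E * (1 / p) ^ card (l E v) * bern_expect V p (\<lambda>P. of_bool (l E v \<subseteq> P)))"
      unfolding A_def by (simp only: bern_expect_sum bern_expect_cmult)
    also have "\<dots> = d v"
      unfolding d_def
    proof (rule sum.cong)
      fix E assume "E \<in> ?G"
      then have "l E v \<subseteq> V" using GV by (auto simp: l_def)
      then show "c v E * (1 / p) ^ card (l E v) * bern_expect V p (\<lambda>P. of_bool (l E v \<subseteq> P)) = c v E"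
        using assms(1,5) by (simp add: bern_expect_subset power_divide)
    qed simp
    finally show ?thesis .
  qed
  \<comment> \<open>On \<open>D\<close> each edge has a vertex outside \<open>P \<union> S\<close>,
    so its telescoping sum is 1; the edges lie in \<open>C\<close>, so only vertices of
    \<open>C - S\<close> occur.\<close>
  have total: "g P * e = (\<Sum>v\<in>C - S. g P * (A v P * (1 - of_bool (v \<in> P) / p)))" for P
  proof (cases "D (P \<union> S)")
    case True
    have "(\<Sum>v\<in>C - S. A v P * (1 - of_bool (v \<in> P) / p)) =
        (\<Sum>E\<in>?G. \<Sum>v\<in>C - S. c v E * (1 / p) ^ card (l E v) * of_bool (l E v \<subseteq> P) * (1 - of_bool (v \<in> P) / p))"
      unfolding A_def sum_distrib_right by (rule sum.swap)
    also have "\<dots> = (\<Sum>E\<in>?G. \<nu> E)"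
    proof (rule sum.cong)
      fix E assume E: "E \<in> ?G"
      have fin: "finite (C - S)" "finite (E - S)" using assms(1,14) GV[OF E] by (auto intro: finite_subset)
      have "\<not> E - S \<subseteq> P" using True E unfolding D_def induced_def by blast
      then have "(\<Sum>v\<in>E - S. (1 / p) ^ card (l E v) * of_bool (l E v \<subseteq> P) * (1 - of_bool (v \<in> P) / p)) = 1"
        unfolding l_def using fin GV(1)[OF E] \<phi> by (subst telescope_first_missing) (auto intro: inj_on_subset)
      moreover have "(\<Sum>v\<in>C - S. c v E * (1 / p) ^ card (l E v) * of_bool (l E v \<subseteq> P) * (1 - of_bool (v \<in> P) / p)) =
          (\<Sum>v\<in>E - S. \<nu> E * ((1 / p) ^ card (l E v) * of_bool (l E v \<subseteq> P) * (1 - of_bool (v \<in> P) / p)))"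
        using fin GV(2)[OF E] by (intro sum.mono_neutral_cong_right) (auto simp: c_def)
      ultimately show "(\<Sum>v\<in>C - S. c v E * (1 / p) ^ card (l E v) * of_bool (l E v \<subseteq> P) * (1 - of_bool (v \<in> P) / p)) = \<nu> E"
        by (simp only: sum_distrib_left[symmetric])
    qed simp
    finally show ?thesis using True by (simp add: g_def e_def e_nu_def)
  qed (simp add: g_def)
  text \<open>
    Splitting off the mean \<open>d v\<close> keeps vertices of large degree harmless, and the positive part
    makes the remainder \<open>B v\<close> increasing, as Harris' inequality requires.
  \<close>
  have vertex: "bern_expect V p (\<lambda>P. g P * (A v P * (1 - of_bool (v \<in> P) / p))) \<le>
      w * (\<delta> * d v + \<delta> / (4 * t) + t * (bern_expect V p (\<lambda>P. (A v P)\<^sup>2) - (d v)\<^sup>2))"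
    if v: "v \<in> C - S" for v
  proof -
    have g: "0 \<le> g (insert v P)" "g (insert v P) \<le> g P" for P
      using monoD[of "P \<union> S" "insert v P \<union> S"] by (auto simp: g_def)
    \<comment> \<open>AM-GM in the form \<open>x \<le> t * x\<^sup>2 + 1 / (4 * t)\<close>, applied
      to the excess over \<open>d v\<close>.\<close>
    have AB: "A v P \<le> (d v + 1 / (4 * t)) + t * B v P" for P
    proof (cases "A v P \<le> d v")
      case True
      then show ?thesis using t0 by (simp add: B_def add_increasing2)
    next
      case False
      have "0 \<le> (2 * t * (A v P - d v) - 1)\<^sup>2 / (4 * t)" using t0 by simp
      also have "\<dots> = t * (A v P - d v)\<^sup>2 - (A v P - d v) + 1 / (4 * t)"
        using t0 by (simp add: power2_eq_square field_simps)
      finally show ?thesis using False by (simp add: B_def)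
    qed
    have "bern_expect V p (\<lambda>P. g P * (A v P * (1 - of_bool (v \<in> P) / p))) =
        bern_expect V p (\<lambda>P. (g P - g (insert v P)) * A v P)"
      using v assms(1,5,14) A_insert by (intro bern_expect_pivotal) auto
    \<comment> \<open>The constant part keeps the pivotal difference, whose mean is at most
      \<open>\<delta> * w\<close>. For \<open>B\<close> the difference is relaxed to
      \<open>g P\<close>, which is decreasing, while the difference itself need not be
      monotone.\<close>
    also have "\<dots> \<le> bern_expect V p (\<lambda>P. (d v + 1 / (4 * t)) * (g P - g (insert v P)) + t * (B v P * g P))"
    proof (intro bern_expect_mono)
      fix P
      have "(g P - g (insert v P)) * A v P \<le> (g P - g (insert v P)) * ((d v + 1 / (4 * t)) + t * B v P)"
        using g[of P] AB[of P] by (intro mult_left_mono) auto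
      moreover have "0 \<le> g (insert v P) * (t * B v P)"
        using g[of P] t0 by (intro mult_nonneg_nonneg) (auto simp: B_def)
      ultimately show "(g P - g (insert v P)) * A v P \<le> (d v + 1 / (4 * t)) * (g P - g (insert v P)) + t * (B v P * g P)"
        by (simp add: algebra_simps)
    qed (use assms in auto)
    also have "\<dots> = (d v + 1 / (4 * t)) * (w - survival V p D (insert v S)) + t * bern_expect V p (\<lambda>P. B v P * g P)"
      by (simp add: bern_expect_add bern_expect_cmult bern_expect_diff g_def w_def survival_def)
    also have "\<dots> \<le> (d v + 1 / (4 * t)) * (\<delta> * w) + t * ((bern_expect V p (\<lambda>P. (A v P)\<^sup>2) - (d v)\<^sup>2) * w)"
    proof (intro add_mono mult_left_mono)
      show "w - survival V p D (insert v S) \<le> \<delta> * w"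
        using C[of v] v by (simp add: w_def algebra_simps)
      show "0 \<le> d v + 1 / (4 * t)"
        unfolding d_def using c0 t0 by (intro add_nonneg_nonneg sum_nonneg) auto
      have "bern_expect V p (\<lambda>P. B v P * g P) \<le> bern_expect V p (B v) * bern_expect V p g"
      proof (rule bern_expect_harris[OF assms(1)])
        fix P Q :: "'a set" assume "P \<subseteq> Q"
        then show "B v P \<le> B v Q"
          unfolding B_def using A_mono[of P Q v] by (intro power_mono) auto
        show "g Q \<le> g P"
          using monoD[of "P \<union> S" "Q \<union> S"] \<open>P \<subseteq> Q\<close> by (auto simp: g_def)
      qed (use assms in auto)
      also have "bern_expect V p g = w" by (simp add: w_def survival_def g_def[abs_def])
      also have "bern_expect V p (B v) \<le> bern_expect V p (\<lambda>P. (A v P)\<^sup>2 - (2 * d v) * A v P + (d v)\<^sup>2)"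
      proof (intro bern_expect_mono)
        fix P
        have "B v P \<le> (A v P - d v)\<^sup>2" by (simp add: B_def max_def)
        then show "B v P \<le> (A v P)\<^sup>2 - (2 * d v) * A v P + (d v)\<^sup>2"
          by (simp add: power2_eq_square algebra_simps)
      qed (use assms in auto)
      also have "\<dots> = bern_expect V p (\<lambda>P. (A v P)\<^sup>2) - (d v)\<^sup>2"
        using assms(1) expect_A[of v]
        by (simp add: bern_expect_add bern_expect_diff bern_expect_cmult bern_expect_const power2_eq_square)
      finally show "bern_expect V p (\<lambda>P. B v P * g P) \<le> (bern_expect V p (\<lambda>P. (A v P)\<^sup>2) - (d v)\<^sup>2) * w"
        using w0 by simp
    qed (use t0 in auto)
    also have "\<dots> = w * (\<delta> * d v + \<delta> / (4 * t) + t * (bern_expect V p (\<lambda>P. (A v P)\<^sup>2) - (d v)\<^sup>2))"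
      by (simp add: algebra_simps)
    finally show ?thesis .
  qed
  have finC: "finite (C - S)" using assms(1,14) by (auto intro: finite_subset)
  \<comment> \<open>A pair of edges contributes only at common vertices, and summing there over
    initial segments of the intersection gains the factor \<open>p\<close>.\<close>
  have variance: "(\<Sum>v\<in>C - S. bern_expect V p (\<lambda>P. (A v P)\<^sup>2) - (d v)\<^sup>2) \<le> p * Lambda V ?G p \<nu>"
  proof -
    have "(\<Sum>v\<in>C - S. bern_expect V p (\<lambda>P. (A v P)\<^sup>2) - (d v)\<^sup>2) \<le>
        (\<Sum>v\<in>C - S. \<Sum>E\<in>?G. \<Sum>E'\<in>?G. c v E * c v E' * (of_bool (m E E' v \<noteq> {}) * (1 / p) ^ card (m E E' v)))"
      unfolding A_def d_def
    proof (intro sum_mono bern_variance_le)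
      fix v E E' assume E: "E \<in> ?G"
      show "0 \<le> c v E" using E c0 by blast
      show "l E v \<subseteq> V" using GV(1)[OF E] by (auto simp: l_def)
      show "l E v \<inter> l E' v \<subseteq> m E E' v" by (auto simp: l_def m_def)
      show "finite (m E E' v)" using GV(3)[OF E] by (simp add: m_def)
    qed (use assms finG in auto)
    also have "\<dots> = (\<Sum>E\<in>?G. \<Sum>v\<in>C - S. \<Sum>E'\<in>?G. c v E * c v E' * (of_bool (m E E' v \<noteq> {}) * (1 / p) ^ card (m E E' v)))"
      by (rule sum.swap)
    also have "\<dots> = (\<Sum>E\<in>?G. \<Sum>E'\<in>?G. \<Sum>v\<in>C - S. c v E * c v E' * (of_bool (m E E' v \<noteq> {}) * (1 / p) ^ card (m E E' v)))"
      by (intro sum.cong refl sum.swap)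
    also have "\<dots> \<le> (\<Sum>E\<in>?G. \<Sum>E'\<in>?G. p * (\<nu> E * \<nu> E' * pair_weight p (E \<inter> E')))"
    proof (intro sum_mono)
      fix E E' assume E: "E \<in> ?G" "E' \<in> ?G"
      have fin: "finite (E \<inter> E')" using GV E by auto
      have inj: "inj_on \<phi> (E \<inter> E')" using \<phi> GV(1)[OF E(1)] by (auto intro: inj_on_subset)
      have \<nu>\<nu>: "0 \<le> \<nu> E * \<nu> E'" using nonneg E by simp
      have "(\<Sum>v\<in>C - S. c v E * c v E' * (of_bool (m E E' v \<noteq> {}) * (1 / p) ^ card (m E E' v))) =
          (\<Sum>v\<in>E \<inter> E' - S. \<nu> E * \<nu> E' * (of_bool (m E E' v \<noteq> {}) * (1 / p) ^ card (m E E' v)))"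
        using finC GV(2)[OF E(1)] by (intro sum.mono_neutral_cong_right) (auto simp: c_def)
      also have "\<dots> \<le> (\<Sum>v\<in>E \<inter> E'. \<nu> E * \<nu> E' * (of_bool (m E E' v \<noteq> {}) * (1 / p) ^ card (m E E' v)))"
        using fin \<nu>\<nu> assms(5) by (intro sum_mono2 mult_nonneg_nonneg[OF \<nu>\<nu>]) auto
      also have "\<dots> = \<nu> E * \<nu> E' * (\<Sum>v\<in>E \<inter> E'. of_bool (m E E' v \<noteq> {}) * (1 / p) ^ card (m E E' v))"
        by (rule sum_distrib_left[symmetric])
      also have "\<dots> \<le> \<nu> E * \<nu> E' * (p * pair_weight p (E \<inter> E'))"
        unfolding m_def
        by (intro mult_left_mono[OF initial_segments_weight_le[OF fin inj assms(5)] \<nu>\<nu>])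
      finally show "(\<Sum>v\<in>C - S. c v E * c v E' * (of_bool (m E E' v \<noteq> {}) * (1 / p) ^ card (m E E' v))) \<le>
          p * (\<nu> E * \<nu> E' * pair_weight p (E \<inter> E'))"
        by (simp add: mult_ac)
    qed
    also have "\<dots> = p * Lambda V ?G p \<nu>"
      using Lambda_eq_pairs[OF assms(1) finG(2), of p \<nu>] by (simp add: sum_distrib_left)
    finally show ?thesis .
  qed
  have degree: "(\<Sum>v\<in>C - S. d v) \<le> real s * e"
  proof -
    have "(\<Sum>v\<in>C - S. d v) = (\<Sum>E\<in>?G. \<Sum>v\<in>C - S. c v E)"
      unfolding d_def by (rule sum.swap)
    also have "\<dots> \<le> (\<Sum>E\<in>?G. real s * \<nu> E)"
    proof (rule sum_mono)
      fix E assume E: "E \<in> ?G"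
      have "(\<Sum>v\<in>C - S. c v E) = (\<Sum>v\<in>E - S. \<nu> E)"
        using finC GV(2)[OF E] by (intro sum.mono_neutral_cong_right) (auto simp: c_def)
      also have "\<dots> = real (card (E - S)) * \<nu> E" by simp
      also have "\<dots> \<le> real s * \<nu> E"
      proof -
        have "card (E - S) \<le> s" using GV(3,4)[OF E] card_mono[of E "E - S"] by auto
        then show ?thesis using nonneg[OF E] by (intro mult_right_mono) auto
      qed
      finally show "(\<Sum>v\<in>C - S. c v E) \<le> real s * \<nu> E" .
    qed
    finally show ?thesis by (simp add: e_def e_nu_def sum_distrib_left)
  qed
  have "w * e = bern_expect V p (\<lambda>P. g P * e)"
    using bern_expect_cmult[of V p e g] by (simp add: w_def survival_def g_def[abs_def] mult.commute)
  also have "\<dots> = (\<Sum>v\<in>C - S. bern_expect V p (\<lambda>P. g P * (A v P * (1 - of_bool (v \<in> P) / p))))"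
    unfolding total by (rule bern_expect_sum)
  also have "\<dots> \<le> (\<Sum>v\<in>C - S. w * (\<delta> * d v + \<delta> / (4 * t) + t * (bern_expect V p (\<lambda>P. (A v P)\<^sup>2) - (d v)\<^sup>2)))"
    by (intro sum_mono vertex)
  also have "\<dots> = w * (\<delta> * (\<Sum>v\<in>C - S. d v) + real (card (C - S)) * (\<delta> / (4 * t)) +
      t * (\<Sum>v\<in>C - S. bern_expect V p (\<lambda>P. (A v P)\<^sup>2) - (d v)\<^sup>2))"
    by (simp only: sum_distrib_left[symmetric] sum.distrib sum_constant)
  also have "\<dots> \<le> w * (\<delta> * (real s * e) + n * (\<delta> / (4 * t)) + t * (p * Lambda V ?G p \<nu>))"
  proof (intro mult_left_mono add_mono degree variance mult_right_mono)
    show "real (card (C - S)) \<le> n"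
      unfolding n_def using assms(1,14) by (intro of_nat_mono card_mono) auto
  qed (use w0 t0 assms in auto)
  finally have "e \<le> \<delta> * (real s * e) + n * (\<delta> / (4 * t)) + t * (p * Lambda V ?G p \<nu>)"
    using w0 by simp
  moreover have "\<delta> * (real s * e) \<le> e / 4"
    using mult_right_mono[OF assms(8), of e] e0 by (simp add: mult_ac)
  moreover have "n * (\<delta> / (4 * t)) \<le> e / 4"
  proof -
    have "n * (\<delta> / (4 * t)) = 2 ^ 10 * \<delta> * (e / 4)"
      using n0 e0 by (simp add: t_def field_simps)
    also have "\<dots> \<le> 1 * (e / 4)" using assms(9) e0 by (intro mult_right_mono) auto
    finally show ?thesis by simp
  qed
  moreover have "t * (p * Lambda V ?G p \<nu>) < e / 4"
  proof -
    have "t * (p * Lambda V ?G p \<nu>) < t * (p * (e\<^sup>2 / R))"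
      using small t0 assms(5) by (intro mult_strict_left_mono) (auto simp: e_def)
    also have "\<dots> = e * (p * n) / (2 ^ 10 * R)"
      using e0 by (simp add: t_def power2_eq_square field_simps)
    also have "\<dots> \<le> e * (2 ^ 8 * R) / (2 ^ 10 * R)"
      using assms(10,11) e0 by (intro divide_right_mono mult_left_mono) (auto simp: n_def)
    also have "\<dots> = e / 4" using assms(10) by simp
    finally show ?thesis .
  qed
  ultimately show False using e0 by linarith
qed

section \<open>Combining the two rounds\<close>

theorem theorem4p6:
  fixes V :: "'a set" and H :: "'a set set" and s n :: nat and p q R \<alpha> \<eta> :: real
  assumes "s \<le> n"
    and "p > 0" "q > 0" "R > 0" "\<alpha> > 0" "\<eta> > 0"
    and "p \<le> 1 / (2^11 * real s ^ 2)"
    and "2 * p \<le> q" "q \<le> \<alpha>" "\<alpha> < 1"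
    and "R \<ge> p * real n / 2^6"
    and "\<eta> \<le> (1 - \<alpha>) ^ (2 * s) / 4"
    and "finite V" "card V = n"
    and "H \<subseteq> Pow V" "\<forall>E\<in>H. card E = s"
  shows "\<exists>(\<Y> :: ('a set \<times> 'a set) set) g f.
     \<Y> \<subseteq> Pow V \<times> Pow V \<and>
     (\<forall>Y\<in>\<Y>. f Y \<subseteq> V) \<and>
     (\<forall>I \<in> indep_sets V {L. L \<subseteq> V \<and> janson V (induced H L) (p / (q - p)) (\<eta> * R)}.
        g I \<in> \<Y> \<and> fst (g I) \<union> snd (g I) \<subseteq> I \<and> I \<subseteq> f (g I)) \<and>
     (\<forall>(S, T)\<in>\<Y>. real (card S) \<le> 2^11 * p * real s ^ 2 * real n \<and> real (card T) \<le> q * real n / \<alpha>) \<and>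
     (\<forall>Y\<in>\<Y>. \<not> janson V (induced H (f Y)) p R)"
proof -
  \<comment> \<open>Chosen so that \<open>p * n / \<delta>\<close> is exactly the bound required for
    \<open>S\<close>.\<close>
  define \<delta> where "\<delta> = 1 / (2 ^ 11 * real s ^ 2)"
  define D where "D A \<longleftrightarrow> \<not> janson V (induced H A) (p / (q - p)) (\<eta> * R)" for A
  define F where "F T = {E \<in> H. (1 - \<alpha>) ^ card (E - T) * survival V q D T \<le> survival V q D (T \<union> E)}" for T
  define indep where "indep T A \<longleftrightarrow> (\<forall>E\<in>H - F T. \<not> E \<subseteq> A)" for T A
  \<comment> \<open>The container is computed from the pair alone: \<open>F\<close> and
    \<open>indep\<close> depend on \<open>I\<close> only through \<open>T\<close>.\<close>
  define f where "f = (\<lambda>(S, T). {v \<in> V. (1 - \<delta>) * survival V p (indep T) S \<le> survival V p (indep T) (insert v S)})"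
  define Ind where "Ind = indep_sets V {L. L \<subseteq> V \<and> janson V (induced H L) (p / (q - p)) (\<eta> * R)}"
  \<comment> \<open>For \<open>s = 0\<close> the bound on \<open>p\<close> is a division by zero,
    hence \<open>p \<le> 0\<close>.\<close>
  have "s \<noteq> 0" using assms(2,7) by (cases "s = 0") auto
  then have s: "1 \<le> real s" by simp
  then have s2: "1 \<le> real s ^ 2" "real s \<le> real s ^ 2" by (simp_all add: self_le_power)
  have \<delta>: "0 < \<delta>" "\<delta> \<le> 1 / 2 ^ 11"
    using s s2(1) by (auto simp: \<delta>_def field_simps)
  have "\<delta> * real s \<le> \<delta> * real s ^ 2"
    using \<delta>(1) s2(2) by (intro mult_left_mono) auto
  also have "\<dots> = 1 / 2 ^ 11" using s by (simp add: \<delta>_def)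
  finally have \<delta>s: "\<delta> * real s \<le> 1 / 4" by simp
  have p\<delta>: "p \<le> \<delta>" using assms(7) by (simp add: \<delta>_def)
  have finH: "finite H" using assms(13,15) finite_subset by blast
  have n: "V \<noteq> {}" using \<open>s \<noteq> 0\<close> assms(1,14) by auto
  have "\<exists>Y. fst Y \<union> snd Y \<subseteq> I \<and> I \<subseteq> f Y \<and> real (card (fst Y)) \<le> 2^11 * p * real s ^ 2 * real n \<and>
      real (card (snd Y)) \<le> q * real n / \<alpha> \<and> \<not> janson V (induced H (f Y)) p R" if I: "I \<in> Ind" for I
  proof -
    have IV: "I \<subseteq> V" using I by (simp add: Ind_def indep_sets_def)
    have "D A" if "A \<subseteq> I" for A
      using I that IV by (auto simp: Ind_def indep_sets_def D_def)
    then obtain T where T: "T \<subseteq> I" "real (card T) \<le> q * real (card V) / \<alpha>" "0 < survival V q D T"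
        and T_max: "\<And>T'. T \<subseteq> T' \<Longrightarrow> T' \<subseteq> I \<Longrightarrow>
          (1 - \<alpha>) ^ card (T' - T) * survival V q D T \<le> survival V q D T'"
      using exists_fingerprint[of V q \<alpha> I D] assms IV by auto
    \<comment> \<open>For an edge \<open>E\<close> inside \<open>I\<close>, maximality of
      \<open>T\<close> applied to \<open>T \<union> E\<close> puts \<open>E\<close> into
      \<open>F T\<close>.\<close>
    have "indep T A" if "A \<subseteq> I" for A
      unfolding indep_def
    proof (intro ballI notI)
      fix E assume E: "E \<in> H - F T" "E \<subseteq> A"
      then have "(1 - \<alpha>) ^ card (T \<union> E - T) * survival V q D T \<le> survival V q D (T \<union> E)"
        using that T by (intro T_max) auto
      moreover have "T \<union> E - T = E - T" by blast
      ultimately show False using E by (simp add: F_def)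
    qed
    then obtain S where S: "S \<subseteq> I" "real (card S) \<le> p * real (card V) / \<delta>" "0 < survival V p (indep T) S"
        and S_max: "\<And>S'. S \<subseteq> S' \<Longrightarrow> S' \<subseteq> I \<Longrightarrow>
          (1 - \<delta>) ^ card (S' - S) * survival V p (indep T) S \<le> survival V p (indep T) S'"
      using exists_fingerprint[of V p \<delta> I "indep T"] assms(2,13) IV \<delta> p\<delta> by auto
    let ?C = "f (S, T)"
    have "I \<subseteq> ?C"
    proof
      fix v assume v: "v \<in> I"
      show "v \<in> ?C"
      proof (cases "v \<in> S")
        case True
        then have "insert v S = S" by blast
        moreover have "(1 - \<delta>) * survival V p (indep T) S \<le> 1 * survival V p (indep T) S"
          using S(3) \<delta> by (intro mult_right_mono) auto
        ultimately show ?thesis using v IV by (auto simp: f_def)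
      next
        case False
        then have "card (insert v S - S) = 1" by (simp add: insert_Diff_if)
        then show ?thesis using S_max[of "insert v S"] v S(1) IV by (auto simp: f_def)
      qed
    qed
    moreover have "\<not> janson V (induced (H - F T) ?C \<union> induced (F T) ?C) p R"
    proof (rule not_janson_union)
      show "\<not> janson V (induced (H - F T) ?C) p (R / 4)"
      proof (rule container_not_janson[where \<delta> = \<delta> and s = s and D = "indep T" and S = S])
        show "p \<le> 1" using p\<delta> \<delta> by simp
        \<comment> \<open>The hypothesis \<open>R \<ge> p * n / 2^6\<close> together with the factor
          4 lost in the union gives \<open>2 ^ 8\<close>.\<close>
        show "p * real (card V) \<le> 2 ^ 8 * (R / 4)" using assms(11,14) by simp
      qed (use assms n \<delta> \<delta>s S in \<open>auto simp: indep_def f_def\<close>)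
      have "\<not> janson V (F T) p (R / 4)"
        using assms T IV by (intro dense_edges_not_janson[where s = s and \<alpha> = \<alpha> and q = q and \<eta> = \<eta> and T = T and D = D and H = H])
          (auto simp: D_def F_def)
      moreover have "induced (F T) ?C \<subseteq> F T" "finite (F T)"
        using finH by (auto simp: induced_def F_def)
      ultimately show "\<not> janson V (induced (F T) ?C) p (R / 4)"
        using janson_mono by blast
    qed (use finH assms in \<open>auto simp: induced_def F_def\<close>)
    moreover have "induced (H - F T) ?C \<union> induced (F T) ?C = induced H ?C"
      by (auto simp: induced_def F_def)
    moreover have "p * real (card V) / \<delta> = 2^11 * p * real s ^ 2 * real n"
      using assms(14) by (simp add: \<delta>_def)
    ultimately show ?thesis
      using S T assms(14) by (intro exI[of _ "(S, T)"]) auto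
  qed
  then obtain g where g: "\<And>I. I \<in> Ind \<Longrightarrow> fst (g I) \<union> snd (g I) \<subseteq> I \<and> I \<subseteq> f (g I) \<and>
      real (card (fst (g I))) \<le> 2^11 * p * real s ^ 2 * real n \<and>
      real (card (snd (g I))) \<le> q * real n / \<alpha> \<and> \<not> janson V (induced H (f (g I))) p R"
    by metis
  \<comment> \<open>The family is the image of \<open>g\<close>, so each of its pairs comes from
    some \<open>I\<close> and inherits the properties chosen for that \<open>I\<close>.\<close>
  have "g ` Ind \<subseteq> Pow V \<times> Pow V"
  proof
    fix Y assume "Y \<in> g ` Ind"
    then obtain I where "I \<in> Ind" "Y = g I" by blast
    then show "Y \<in> Pow V \<times> Pow V"
      using g[of I] by (auto simp: Ind_def indep_sets_def mem_Times_iff)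
  qed
  moreover have "\<forall>Y\<in>g ` Ind. f Y \<subseteq> V"
    by (auto simp: f_def)
  moreover have "\<forall>(S, T)\<in>g ` Ind. real (card S) \<le> 2^11 * p * real s ^ 2 * real n \<and> real (card T) \<le> q * real n / \<alpha>"
    using g by (simp add: case_prod_beta)
  moreover have "\<forall>Y\<in>g ` Ind. \<not> janson V (induced H (f Y)) p R"
    using g by blast
  moreover have "\<forall>I\<in>Ind. g I \<in> g ` Ind \<and> fst (g I) \<union> snd (g I) \<subseteq> I \<and> I \<subseteq> f (g I)"
    using g by blast
  ultimately show ?thesis
    unfolding Ind_def[symmetric] by (intro exI[of _ "g ` Ind"] exI[of _ g] exI[of _ f] conjI)
qed

end
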